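(* Let $n_1,\dots,n_d$ be positive integers and let $P=\Pi_d(n_1,\dots,n_d)$ be the pile of cubes. Then every Sperner labelling $L:V(P)\to\{0,1\}^d$ of $P$ admits at least one centrally labelled cell of $P$.
   Context: The pile of cubes $\Pi_d(n_1,\dots,n_d)$ is the polytopal complex formed by all unit cubes with integer vertices contained in the box $B=\{x\in\mathbb{R}^d: 0\le x_i\le n_i,\ 1\le i\le d\}$, together with all their faces; $V(P)$ is the set of integer points of $B$. $C^d=[0,1]^d$, with vertex set $\{0,1\}^d$. The corner $(\varepsilon_1 n_1,\dots,\varepsilon_d n_d)$ of $B$ ($\varepsilon\in\{0,1\}^d$) corresponds to the vertex $\varepsilon$ of $C^d$, and correspondingly each face of $B$ corresponds to a face of $C^d$. A labelling $L:V(P)\to\{0,1\}^d$ is Sperner if each corner of $B$ receives its corresponding vertex of $C^d$ as label, and each vertex of $P$ lying in the relative interior of a face $F$ of $B$ receives as label a vertex of the corresponding face of $C^d$. For each $k$-cell $\sigma$ of $P$ (a unit $k$-cube, identified with $C^k$) let $f_L|_\sigma$ be the unique map $\sigma\to C^d$ whose coordinates are polynomials of degree at most 1 in each variable separately and which agrees with $L$ at the vertices of $\sigma$; these glue to $f_L:B\to C^d$. A cell $\sigma$ is centrally labelled if some point $x$ in the relative interior of $\sigma$ satisfies $f_L(x)=(1/2,\dots,1/2)$. *)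

theory Defs
  imports "HOL-Analysis.Analysis"
begin

definition box_of :: "('d::finite \<Rightarrow> nat) \<Rightarrow> (real^'d) set" where
  "box_of n = {x. \<forall>i. 0 \<le> x $ i \<and> x $ i \<le> real (n i)}"

definition integer_point :: "real^'d::finite \<Rightarrow> bool" where
  "integer_point v \<longleftrightarrow> (\<forall>i. v $ i \<in> \<int>)"

definition unit_cube_at :: "real^'d::finite \<Rightarrow> (real^'d) set" where
  "unit_cube_at v = cbox v (\<chi> i. v $ i + 1)"

definition pile_cells :: "('d::finite \<Rightarrow> nat) \<Rightarrow> (real^'d) set set" where
  "pile_cells n = {\<sigma>. \<sigma> \<noteq> {} \<and>
     (\<exists>v. integer_point v \<and> unit_cube_at v \<subseteq> box_of n \<and> \<sigma> face_of unit_cube_at v)}"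

definition pile_vertices :: "('d::finite \<Rightarrow> nat) \<Rightarrow> (real^'d) set" where
  "pile_vertices n = {v \<in> box_of n. integer_point v}"

definition cube_vertices :: "(real^'d::finite) set" where
  "cube_vertices = {e. \<forall>i. e $ i \<in> {0, 1}}"

definition corner :: "('d::finite \<Rightarrow> nat) \<Rightarrow> real^'d \<Rightarrow> real^'d" where
  "corner n e = (\<chi> i. e $ i * real (n i))"

(* The face of the cube [0,1]^d spanned by the vertices that correspond to the corners of F. *)
definition corresponding_face :: "('d::finite \<Rightarrow> nat) \<Rightarrow> (real^'d) set \<Rightarrow> (real^'d) set" where
  "corresponding_face n F = convex hull {e \<in> cube_vertices. corner n e \<in> F}"

(* Only the values of L on pile_vertices n are relevant. *)
definition sperner_labelling ::
    "('d::finite \<Rightarrow> nat) \<Rightarrow> (real^'d \<Rightarrow> real^'d) \<Rightarrow> bool" where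
  "sperner_labelling n L \<longleftrightarrow>
     L \<in> pile_vertices n \<rightarrow> cube_vertices \<and>
     (\<forall>e\<in>cube_vertices. L (corner n e) = e) \<and>
     (\<forall>F v. F face_of box_of n \<longrightarrow> v \<in> pile_vertices n \<longrightarrow> v \<in> rel_interior F \<longrightarrow>
        L v extreme_point_of corresponding_face n F)"

(* Polynomial functions of degree at most 1 in each variable separately:
   linear combinations of the squarefree monomials. *)
definition multiaffine :: "(real^'d::finite \<Rightarrow> real) \<Rightarrow> bool" where
  "multiaffine p \<longleftrightarrow> (\<exists>c :: 'd set \<Rightarrow> real. \<forall>x. p x = (\<Sum>S\<in>UNIV. c S * (\<Prod>i\<in>S. x $ i)))"

(* On a k-cell, d - k of the coordinates are constant and the others are coordinates of C^k up to
   a translation, so the polynomials on the cell of degree at most 1 in each of its k variables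
   are exactly the restrictions of multiaffine polynomials in all d variables. *)
definition is_interpolation ::
    "(real^'d::finite \<Rightarrow> real^'d) \<Rightarrow> (real^'d) set \<Rightarrow> (real^'d \<Rightarrow> real^'d) \<Rightarrow> bool" where
  "is_interpolation L \<sigma> g \<longleftrightarrow>
     (\<forall>j. \<exists>p. multiaffine p \<and> (\<forall>x\<in>\<sigma>. g x $ j = p x)) \<and>
     (\<forall>v. v extreme_point_of \<sigma> \<longrightarrow> g v = L v)"

(* The restriction of f_L to a cell; extensionality makes the map unique as a total function. *)
definition cell_map ::
    "(real^'d::finite \<Rightarrow> real^'d) \<Rightarrow> (real^'d) set \<Rightarrow> (real^'d \<Rightarrow> real^'d)" where
  "cell_map L \<sigma> = (THE g. g \<in> extensional \<sigma> \<and> is_interpolation L \<sigma> g)"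

definition centrally_labelled ::
    "(real^'d::finite \<Rightarrow> real^'d) \<Rightarrow> (real^'d) set \<Rightarrow> bool" where
  "centrally_labelled L \<sigma> \<longleftrightarrow> (\<exists>x\<in>rel_interior \<sigma>. cell_map L \<sigma> x = (\<chi> i. 1/2))"

end

theory Submission
  imports Defs
begin

text \<open>
  The maps on the cells glue to the single function \<open>x \<mapsto> (\<Sum>v. (\<Prod>i. hat (x\<^sub>i - v\<^sub>i)) L(v))\<close>, where
  \<open>hat t = max 0 (1 - \<bar>t\<bar>)\<close>: it is visibly continuous, and multiaffine on every unit cube because
  each factor is affine there. The Sperner condition says that its \<open>i\<close>-th coordinate is 0 on the
  facet \<open>x\<^sub>i = 0\<close> of the box and 1 on the facet \<open>x\<^sub>i = n\<^sub>i\<close>, so by the Poincare-Miranda theorem it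
  takes the value \<open>(1/2, \<dots>, 1/2)\<close>, at a point in the relative interior of some cell.
\<close>

section \<open>Zeros of continuous maps on a box, and faces of polytopes\<close>

text \<open>Reduction to Brouwer: \<open>x - f x\<close>, clamped coordinatewise to the box, is a
  continuous self-map of the box, and the sign conditions turn its fixed points into zeros of
  \<open>f\<close>.\<close>

theorem Poincare_Miranda:
  fixes f :: "'a::euclidean_space \<Rightarrow> 'a"
  assumes cont: "continuous_on (cbox a b) f"
    and less: "\<And>i. i \<in> Basis \<Longrightarrow> a \<bullet> i < b \<bullet> i"
    and lower: "\<And>x i. x \<in> cbox a b \<Longrightarrow> i \<in> Basis \<Longrightarrow> x \<bullet> i = a \<bullet> i \<Longrightarrow> f x \<bullet> i \<le> 0"
    and upper: "\<And>x i. x \<in> cbox a b \<Longrightarrow> i \<in> Basis \<Longrightarrow> x \<bullet> i = b \<bullet> i \<Longrightarrow> f x \<bullet> i \<ge> 0"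
  obtains x where "x \<in> cbox a b" "f x = 0"
proof -
  define g where "g x = (\<Sum>i\<in>Basis. max (a \<bullet> i) (min (b \<bullet> i) (x \<bullet> i - f x \<bullet> i)) *\<^sub>R i)" for x
  have g_inner: "g x \<bullet> i = max (a \<bullet> i) (min (b \<bullet> i) (x \<bullet> i - f x \<bullet> i))" if "i \<in> Basis" for x i
    using that by (simp add: g_def)
  have "continuous_on (cbox a b) g"
    unfolding g_def by (intro continuous_intros cont)
  moreover have "g \<in> cbox a b \<rightarrow> cbox a b"
    using less by (auto simp: mem_box g_inner less_imp_le)
  moreover have "interior (cbox a b) \<noteq> {}"
    using less by (simp add: interior_cbox box_ne_empty)
  ultimately obtain x where x: "x \<in> cbox a b" "g x = x"
    using brouwer_weak[of "cbox a b" g] by (auto simp: compact_cbox)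
  have "f x \<bullet> i = 0" if i: "i \<in> Basis" for i
  proof -
    have fixed: "x \<bullet> i = max (a \<bullet> i) (min (b \<bullet> i) (x \<bullet> i - f x \<bullet> i))"
      using g_inner[OF i, of x] x(2) by simp
    \<comment> \<open>Strictly between the bounds nothing was clamped, so the coordinate of
      \<open>f x\<close> is 0. At the lower bound the fixed point equation gives a value
      \<open>\<ge> 0\<close>, at the upper bound a value \<open>\<le> 0\<close>; the sign conditions
      give the opposite inequalities.\<close>
    show ?thesis
      using fixed less[OF i] lower[OF x(1) i] upper[OF x(1) i]
      by (cases "x \<bullet> i = a \<bullet> i"; cases "x \<bullet> i = b \<bullet> i") (auto simp: max_def min_def split: if_splits)
  qed
  then have "f x = 0"
    by (simp add: euclidean_eq_iff[of "f x"])
  with x(1) show thesis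
    by (rule that)
qed

text \<open>The smallest face containing \<open>x\<close> works: if \<open>x\<close> lay on its
  relative boundary, it would lie in a facet of that face, which is a strictly smaller face
  containing \<open>x\<close>.\<close>

lemma polytope_rel_interior_face_exists:
  fixes S :: "'a::euclidean_space set"
  assumes S: "polytope S" and x: "x \<in> S"
  obtains F where "F face_of S" "x \<in> rel_interior F"
proof -
  define F where "F = \<Inter>{T. T face_of S \<and> x \<in> T}"
  have "S face_of S"
    by (simp add: S face_of_refl polytope_imp_convex)
  then have F: "F face_of S"
    unfolding F_def using x by (intro face_of_Inter) auto
  have xF: "x \<in> F"
    by (auto simp: F_def)
  have "polyhedron F"
    using F S face_of_polytope_polytope polytope_imp_polyhedron by blast
  then have boundary: "F - rel_interior F = \<Union>{G. G facet_of F}"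
    by (rule rel_boundary_of_polyhedron)
  have "x \<in> rel_interior F"
  proof (rule ccontr)
    assume "x \<notin> rel_interior F"
    with xF boundary obtain G where G: "G facet_of F" "x \<in> G"
      by blast
    then have "G face_of S"
      using F facet_of_imp_face_of face_of_trans by blast
    with G have "F \<subseteq> G"
      by (auto simp: F_def)
    with G have "G = F"
      using facet_of_imp_subset by blast
    with G(1) show False
      by (simp add: facet_of_def)
  qed
  with F show thesis
    by (rule that)
qed

section \<open>Multiaffine functions on faces of a unit cube\<close>

lemma multiaffine_diff:
  assumes "multiaffine p" "multiaffine q"
  shows "multiaffine (\<lambda>x. p x - q x)"
proof -
  from assms obtain c d where "\<forall>x. p x = (\<Sum>S\<in>UNIV. c S * (\<Prod>i\<in>S. x $ i))"
    "\<forall>x. q x = (\<Sum>S\<in>UNIV. d S * (\<Prod>i\<in>S. x $ i))"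
    unfolding multiaffine_def by blast
  then show ?thesis
    unfolding multiaffine_def
    by (intro exI[of _ "\<lambda>S. c S - d S"]) (simp add: sum_subtractf left_diff_distrib)
qed

lemma multiaffine_sum_scaled:
  assumes "\<And>v. v \<in> V \<Longrightarrow> multiaffine (p v)"
  shows "multiaffine (\<lambda>x. \<Sum>v\<in>V. p v x * a v)"
proof -
  from assms obtain c where c: "\<And>v x. v \<in> V \<Longrightarrow> p v x = (\<Sum>S\<in>UNIV. c v S * (\<Prod>i\<in>S. x $ i))"
    unfolding multiaffine_def by metis
  have "(\<Sum>v\<in>V. p v x * a v) = (\<Sum>S\<in>UNIV. (\<Sum>v\<in>V. c v S * a v) * (\<Prod>i\<in>S. x $ i))" for x
  proof -
    have "(\<Sum>v\<in>V. p v x * a v) = (\<Sum>v\<in>V. \<Sum>S\<in>UNIV. c v S * a v * (\<Prod>i\<in>S. x $ i))"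
      by (intro sum.cong) (simp_all add: c sum_distrib_left mult_ac)
    also have "\<dots> = (\<Sum>S\<in>UNIV. \<Sum>v\<in>V. c v S * a v * (\<Prod>i\<in>S. x $ i))"
      by (rule sum.swap)
    finally show ?thesis
      by (simp add: sum_distrib_right)
  qed
  then show ?thesis
    unfolding multiaffine_def by (intro exI allI)
qed

text \<open>Expanding the product picks one summand from each factor; \<open>S\<close> collects the
  indices where the \<open>x\<close> term is picked, so only squarefree monomials arise.\<close>

lemma multiaffine_prod_affine:
  "multiaffine (\<lambda>x. \<Prod>i\<in>UNIV. a i * x $ i + b i)"
  unfolding multiaffine_def
  by (intro exI[of _ "\<lambda>S. prod a S * prod b (UNIV - S)"])
    (simp add: prod_add prod.distrib mult_ac)

lemma multiaffine_const: "multiaffine (\<lambda>x :: real^'d::finite. a)"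
proof -
  have "a = (\<Sum>S\<in>UNIV. (if S = {} then a else 0) * (\<Prod>i\<in>S. x $ i))" for x :: "real^'d"
  proof -
    have "(if S = {} then a else 0) * (\<Prod>i\<in>S. x $ i) = (if S = {} then a else 0)" for S
      by simp
    then show ?thesis
      by (simp only:) simp
  qed
  then show ?thesis
    unfolding multiaffine_def by (intro exI allI)
qed

definition upd_coord :: "real^'d::finite \<Rightarrow> 'd \<Rightarrow> real \<Rightarrow> real^'d" where
  "upd_coord x i t = (\<chi> k. if k = i then t else x $ k)"

lemma upd_coord_nth [simp]: "upd_coord x i t $ k = (if k = i then t else x $ k)"
  by (simp add: upd_coord_def)

lemma upd_coord_same [simp]: "upd_coord x i (x $ i) = x"
  by (simp add: vec_eq_iff)

lemma multiaffine_affine_in_coord: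
  assumes "multiaffine p"
  obtains a b where "\<And>t. p (upd_coord x i t) = a * t + b"
proof -
  from assms obtain c where c: "\<And>x. p x = (\<Sum>S\<in>UNIV. c S * (\<Prod>i\<in>S. x $ i))"
    unfolding multiaffine_def by blast
  \<comment> \<open>A squarefree monomial contains the variable \<open>i\<close> once or not at all:
    the first kind contributes to the slope, the second to the constant term.\<close>
  have "c S * (\<Prod>k\<in>S. upd_coord x i t $ k) =
      (if i \<in> S then c S * (\<Prod>k\<in>S - {i}. x $ k) else 0) * t +
      (if i \<in> S then 0 else c S * (\<Prod>k\<in>S. x $ k))" for S t
  proof (cases "i \<in> S")
    case True
    then have "(\<Prod>k\<in>S. upd_coord x i t $ k) = t * (\<Prod>k\<in>S - {i}. upd_coord x i t $ k)"
      by (subst prod.remove[of S i]) auto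
    also have "(\<Prod>k\<in>S - {i}. upd_coord x i t $ k) = (\<Prod>k\<in>S - {i}. x $ k)"
      by (intro prod.cong) auto
    finally show ?thesis
      using True by simp
  next
    case False
    then have "(\<Prod>k\<in>S. upd_coord x i t $ k) = (\<Prod>k\<in>S. x $ k)"
      by (intro prod.cong) auto
    with False show ?thesis
      by simp
  qed
  then have "p (upd_coord x i t) =
      (\<Sum>S\<in>UNIV. if i \<in> S then c S * (\<Prod>k\<in>S - {i}. x $ k) else 0) * t +
      (\<Sum>S\<in>UNIV. if i \<in> S then 0 else c S * (\<Prod>k\<in>S. x $ k))" for t
    unfolding c by (simp add: sum.distrib sum_distrib_right)
  then show thesis
    by (rule that)
qed

lemma mem_unit_cube_at: "x \<in> unit_cube_at v \<longleftrightarrow> (\<forall>i. v $ i \<le> x $ i \<and> x $ i \<le> v $ i + 1)"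
  by (simp add: unit_cube_at_def mem_box_cart)

lemma open_segment_upd_coord:
  assumes "s < x $ i" "x $ i < t"
  shows "x \<in> open_segment (upd_coord x i s) (upd_coord x i t)"
proof -
  \<comment> \<open>The ratio in which \<open>x $ i\<close> divides the interval from
    \<open>s\<close> to \<open>t\<close>.\<close>
  define u where "u = (x $ i - s) / (t - s)"
  have "u * (t - s) = x $ i - s"
    using assms by (simp add: u_def)
  then have "x = (1 - u) *\<^sub>R upd_coord x i s + u *\<^sub>R upd_coord x i t"
    by (simp add: vec_eq_iff algebra_simps)
  moreover have "0 < u" "u < 1"
    using assms by (auto simp: u_def)
  moreover have "upd_coord x i s \<noteq> upd_coord x i t"
    using assms by (auto simp: vec_eq_iff)
  ultimately show ?thesis
    unfolding in_segment by blast
qed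

lemma extreme_point_of_unit_cube_at:
  "x extreme_point_of unit_cube_at v \<longleftrightarrow> (\<forall>i. x $ i = v $ i \<or> x $ i = v $ i + 1)"
proof
  assume x: "x extreme_point_of unit_cube_at v"
  then have mem: "x \<in> unit_cube_at v"
    by (simp add: extreme_point_of_def)
  show "\<forall>i. x $ i = v $ i \<or> x $ i = v $ i + 1"
  proof (rule ccontr)
    assume "\<not> ?thesis"
    then obtain i where "v $ i < x $ i" "x $ i < v $ i + 1"
      using mem by (metis mem_unit_cube_at order_le_less)
    then have "x \<in> open_segment (upd_coord x i (v $ i)) (upd_coord x i (v $ i + 1))"
      by (rule open_segment_upd_coord)
    moreover have "upd_coord x i (v $ i) \<in> unit_cube_at v" "upd_coord x i (v $ i + 1) \<in> unit_cube_at v"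
      using mem by (auto simp: mem_unit_cube_at)
    ultimately show False
      using x unfolding extreme_point_of_def by blast
  qed
next
  assume x: "\<forall>i. x $ i = v $ i \<or> x $ i = v $ i + 1"
  have False if ab: "a \<in> unit_cube_at v" "b \<in> unit_cube_at v" and seg: "x \<in> open_segment a b" for a b
  proof -
    from seg obtain u where u: "a \<noteq> b" "0 < u" "u < 1" "x = (1 - u) *\<^sub>R a + u *\<^sub>R b"
      by (auto simp: in_segment)
    have "a $ i = b $ i" for i
    proof -
      have lo: "(1 - u) * (a $ i - v $ i) \<ge> 0" "u * (b $ i - v $ i) \<ge> 0"
        and hi: "(1 - u) * (v $ i + 1 - a $ i) \<ge> 0" "u * (v $ i + 1 - b $ i) \<ge> 0"
        using ab u by (simp_all add: mem_unit_cube_at)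
      \<comment> \<open>The distances of \<open>x $ i\<close> from the two ends are positive
        combinations of those of \<open>a $ i\<close> and \<open>b $ i\<close>. If one of them is 0,
        both of its nonnegative summands vanish, so \<open>a\<close> and \<open>b\<close> agree in
        this coordinate.\<close>
      have lo_sum: "x $ i - v $ i = (1 - u) * (a $ i - v $ i) + u * (b $ i - v $ i)"
        and hi_sum: "v $ i + 1 - x $ i = (1 - u) * (v $ i + 1 - a $ i) + u * (v $ i + 1 - b $ i)"
        unfolding u(4) by (simp_all add: algebra_simps)
      consider "x $ i = v $ i" | "x $ i = v $ i + 1"
        using x by blast
      then show ?thesis
      proof cases
        case 1
        then have "(1 - u) * (a $ i - v $ i) = 0" "u * (b $ i - v $ i) = 0"
          using lo lo_sum by linarith+
        with u show ?thesis by simp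
      next
        case 2
        then have "(1 - u) * (v $ i + 1 - a $ i) = 0" "u * (v $ i + 1 - b $ i) = 0"
          using hi hi_sum by linarith+
        with u show ?thesis by simp
      qed
    qed
    with u(1) show False
      by (simp add: vec_eq_iff)
  qed
  moreover have "x \<in> unit_cube_at v"
    unfolding mem_unit_cube_at
  proof
    fix i
    show "v $ i \<le> x $ i \<and> x $ i \<le> v $ i + 1"
      using x[rule_format, of i] by auto
  qed
  ultimately show "x extreme_point_of unit_cube_at v"
    unfolding extreme_point_of_def by blast
qed

text \<open>This gives uniqueness of the interpolation on a cell. Induction on the number of
  coordinates of \<open>x\<close> that are not at an end of the cube: pushing one of them to both
  ends gives two points with fewer such coordinates, and \<open>p\<close> is affine on the segment
  between them.\<close>

lemma multiaffine_zero_on_face: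
  assumes p: "multiaffine p" and face: "\<sigma> face_of unit_cube_at v"
    and zero: "\<And>u. u extreme_point_of \<sigma> \<Longrightarrow> p u = 0"
    and x: "x \<in> \<sigma>"
  shows "p x = 0"
  using x
proof (induction "card {i. x $ i \<noteq> v $ i \<and> x $ i \<noteq> v $ i + 1}" arbitrary: x rule: less_induct)
  case less
  let ?I = "\<lambda>x. {i. x $ i \<noteq> v $ i \<and> x $ i \<noteq> v $ i + 1}"
  have mem: "x \<in> unit_cube_at v"
    using less.prems face face_of_imp_subset by blast
  show ?case
  proof (cases "?I x = {}")
    case True
    then have "x extreme_point_of unit_cube_at v"
      by (auto simp: extreme_point_of_unit_cube_at)
    then show ?thesis
      using zero face extreme_point_of_face less.prems by blast
  next
    case False
    then obtain i where i: "i \<in> ?I x"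
      by blast
    then have between: "v $ i < x $ i" "x $ i < v $ i + 1"
      using mem by (auto simp: mem_unit_cube_at order_le_less)
    let ?y = "\<lambda>t. upd_coord x i t"
    have "?y (v $ i) \<in> unit_cube_at v" "?y (v $ i + 1) \<in> unit_cube_at v"
      using mem by (auto simp: mem_unit_cube_at)
    \<comment> \<open>\<open>x\<close> lies inside a segment of the cube and belongs to the face, so
      the face contains the endpoints too.\<close>
    then have ends: "?y (v $ i) \<in> \<sigma>" "?y (v $ i + 1) \<in> \<sigma>"
      using face_ofD[OF face open_segment_upd_coord[OF between]] less.prems by blast+
    have "?I (?y t) \<subset> ?I x" if "t = v $ i \<or> t = v $ i + 1" for t
      using that i by (auto split: if_splits)
    then have smaller: "card (?I (?y t)) < card (?I x)" if "t = v $ i \<or> t = v $ i + 1" for t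
      using that by (intro psubset_card_mono) auto
    have "p (?y (v $ i)) = 0" "p (?y (v $ i + 1)) = 0"
      using less.hyps[OF smaller] ends by blast+
    moreover obtain a b where ab: "\<And>t. p (?y t) = a * t + b"
      using multiaffine_affine_in_coord[OF p] by blast
    \<comment> \<open>The two zeros are at arguments that differ by 1, so the slope vanishes
      first.\<close>
    ultimately have "a = 0" "b = 0"
      by (auto simp: algebra_simps)
    then show ?thesis
      using ab[of "x $ i"] by simp
  qed
qed

section \<open>The glued interpolation map\<close>

text \<open>The nodal basis function of piecewise linear interpolation at the integers.\<close>

definition hat :: "real \<Rightarrow> real" where
  "hat t = max 0 (1 - \<bar>t\<bar>)"

lemma hat_int:
  assumes "t \<in> \<int>"
  shows "hat t = (if t = 0 then 1 else 0)"
  using Ints_nonzero_abs_ge1[OF assms] by (auto simp: hat_def)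

text \<open>The kinks of the shifted hat are at the integers \<open>v - 1\<close>, \<open>v\<close>
  and \<open>v + 1\<close>, none of which is interior to a unit interval with integer ends.\<close>

lemma hat_affine_on_unit_interval:
  assumes "v \<in> \<int>" "w \<in> \<int>"
  obtains a b where "\<And>t. w \<le> t \<Longrightarrow> t \<le> w + 1 \<Longrightarrow> hat (t - v) = a * t + b"
proof -
  obtain m k :: int where mk: "v = of_int m" "w = of_int k"
    using assms by (auto elim!: Ints_cases)
  \<comment> \<open>In the outer cases the interval misses the open support of the hat;
    \<open>m = k\<close> is its falling branch and \<open>m = k + 1\<close> its rising one.\<close>
  consider "m \<le> k - 1" | "m = k" | "m = k + 1" | "m \<ge> k + 2"
    by linarith
  then show thesis
  proof cases
    case 1
    then have "v \<le> w - 1" unfolding mk by linarith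
    then show thesis by (intro that[of 0 0]) (auto simp: hat_def)
  next
    case 2
    then have "v = w" unfolding mk by simp
    then show thesis by (intro that[of "-1" "1 + v"]) (auto simp: hat_def)
  next
    case 3
    then have "v = w + 1" unfolding mk by simp
    then show thesis by (intro that[of 1 "1 - v"]) (auto simp: hat_def)
  next
    case 4
    then have "v \<ge> w + 2" unfolding mk by linarith
    then show thesis by (intro that[of 0 0]) (auto simp: hat_def)
  qed
qed

definition pile_interp :: "('d::finite \<Rightarrow> nat) \<Rightarrow> (real^'d \<Rightarrow> real^'d) \<Rightarrow> real^'d \<Rightarrow> real^'d" where
  "pile_interp n L x = (\<Sum>v\<in>pile_vertices n. (\<Prod>i\<in>UNIV. hat (x $ i - v $ i)) *\<^sub>R L v)"

lemma continuous_on_pile_interp: "continuous_on S (pile_interp n L)"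
  unfolding pile_interp_def hat_def by (intro continuous_intros)

lemma box_of_eq_cbox: "box_of n = cbox 0 (\<chi> i. real (n i))"
  by (auto simp: box_of_def mem_box_cart)

text \<open>Ensures that the sum in \<open>pile_interp\<close> is a genuine one, as a sum over an
  infinite set is 0 by convention.\<close>

lemma finite_pile_vertices: "finite (pile_vertices n)"
proof (rule finite_subset)
  show "pile_vertices n \<subseteq> (\<lambda>k. \<chi> i. real (k i)) ` (PiE UNIV (\<lambda>i. {..n i}))"
  proof
    fix v assume v: "v \<in> pile_vertices n"
    have "\<exists>k. v $ i = real k \<and> k \<le> n i" for i
    proof -
      have "v $ i \<in> \<nat>"
        using v by (auto simp: pile_vertices_def integer_point_def box_of_def Nats_altdef2)
      then show ?thesis
        using v by (auto simp: pile_vertices_def box_of_def elim!: Nats_cases)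
           (metis of_nat_le_iff)
    qed
    then obtain k where "\<And>i. v $ i = real (k i) \<and> k i \<le> n i"
      by metis
    then show "v \<in> (\<lambda>k. \<chi> i. real (k i)) ` (PiE UNIV (\<lambda>i. {..n i}))"
      by (intro image_eqI[of _ _ k]) (auto simp: vec_eq_iff PiE_UNIV_domain)
  qed
qed (simp add: finite_PiE)

text \<open>Between integer points the weights are Kronecker deltas: a single differing coordinate
  makes one factor 0.\<close>

lemma pile_interp_vertex:
  assumes u: "u \<in> pile_vertices n"
  shows "pile_interp n L u = L u"
proof -
  have "(\<Prod>i\<in>UNIV. hat (u $ i - v $ i)) = (if v = u then 1 else 0)" if v: "v \<in> pile_vertices n" for v
  proof -
    have "hat (u $ i - v $ i) = (if u $ i = v $ i then 1 else 0)" for i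
      using u v by (subst hat_int) (auto simp: pile_vertices_def integer_point_def)
    then show ?thesis
      by (auto simp: vec_eq_iff intro!: prod_zero) metis
  qed
  then have "pile_interp n L u = (\<Sum>v\<in>pile_vertices n. if v = u then L u else 0)"
    unfolding pile_interp_def by (intro sum.cong) auto
  then show ?thesis
    using u by (simp add: finite_pile_vertices)
qed

lemma pile_interp_multiaffine:
  assumes w: "integer_point w"
  obtains p where "multiaffine p" "\<And>x. x \<in> unit_cube_at w \<Longrightarrow> pile_interp n L x $ j = p x"
proof -
  have "\<exists>a b. \<forall>t. w $ i \<le> t \<longrightarrow> t \<le> w $ i + 1 \<longrightarrow> hat (t - v $ i) = a * t + b"
    if v: "v \<in> pile_vertices n" for v i
  proof -
    have "v $ i \<in> \<int>" "w $ i \<in> \<int>"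
      using v w by (auto simp: pile_vertices_def integer_point_def)
    then show ?thesis
      by (rule hat_affine_on_unit_interval) blast
  qed
  then obtain a b where ab: "\<And>v i t. v \<in> pile_vertices n \<Longrightarrow> w $ i \<le> t \<Longrightarrow> t \<le> w $ i + 1 \<Longrightarrow>
      hat (t - v $ i) = a v i * t + b v i"
    by metis
  let ?p = "\<lambda>x. \<Sum>v\<in>pile_vertices n. (\<Prod>i\<in>UNIV. a v i * x $ i + b v i) * L v $ j"
  show thesis
  proof
    show "multiaffine ?p"
      by (intro multiaffine_sum_scaled multiaffine_prod_affine)
    show "pile_interp n L x $ j = ?p x" if "x \<in> unit_cube_at w" for x
      using that unfolding pile_interp_def by (simp add: mem_unit_cube_at ab)
  qed
qed

text \<open>Extreme points of a face are extreme points of the cube, whose coordinates are those of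
  \<open>w\<close> or larger by 1.\<close>

lemma face_extreme_point_pile_vertex:
  assumes w: "integer_point w" "unit_cube_at w \<subseteq> box_of n" and face: "\<sigma> face_of unit_cube_at w"
    and u: "u extreme_point_of \<sigma>"
  shows "u \<in> pile_vertices n"
proof -
  have u': "u extreme_point_of unit_cube_at w"
    using face u extreme_point_of_face by blast
  then have "u $ i \<in> \<int>" for i
    using w(1) unfolding extreme_point_of_unit_cube_at integer_point_def
    by (metis Ints_1 Ints_add)
  moreover have "u \<in> box_of n"
    using u' w(2) by (auto simp: extreme_point_of_def)
  ultimately show ?thesis
    by (simp add: pile_vertices_def integer_point_def)
qed

text \<open>The global formula restricted to the cell is an interpolation of \<open>L\<close>. Any
  other has the same vertex values, so the multiaffine difference vanishes on the whole cell, and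
  the definite description in \<open>cell_map\<close> denotes this restriction.\<close>

lemma cell_map_eq_pile_interp:
  assumes w: "integer_point w" "unit_cube_at w \<subseteq> box_of n" and face: "\<sigma> face_of unit_cube_at w"
    and x: "x \<in> \<sigma>"
  shows "cell_map L \<sigma> x = pile_interp n L x"
proof -
  let ?g = "restrict (pile_interp n L) \<sigma>"
  have sub: "\<sigma> \<subseteq> unit_cube_at w"
    using face by (rule face_of_imp_subset)
  have vert: "?g u = L u" if "u extreme_point_of \<sigma>" for u
    using that face_extreme_point_pile_vertex[OF w face] pile_interp_vertex
    by (auto simp: extreme_point_of_def)
  have "\<exists>p. multiaffine p \<and> (\<forall>x\<in>\<sigma>. ?g x $ j = p x)" for j
    by (rule pile_interp_multiaffine[OF w(1), of n L j]) (use sub in auto)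
  then have interp: "is_interpolation L \<sigma> ?g"
    unfolding is_interpolation_def using vert by blast
  have uniq: "h = ?g" if h: "h \<in> extensional \<sigma>" "is_interpolation L \<sigma> h" for h
  proof (rule extensionalityI[OF h(1) restrict_extensional])
    fix y assume y: "y \<in> \<sigma>"
    have "h y $ j = ?g y $ j" for j
    proof -
      obtain p q where p: "multiaffine p" "\<forall>x\<in>\<sigma>. h x $ j = p x"
        and q: "multiaffine q" "\<forall>x\<in>\<sigma>. ?g x $ j = q x"
        using h(2) interp unfolding is_interpolation_def by metis
      have "p u - q u = 0" if "u extreme_point_of \<sigma>" for u
        using that h(2) vert p(2) q(2) unfolding is_interpolation_def
        by (metis extreme_point_of_def diff_self)
      then have "p y - q y = 0"
        using multiaffine_zero_on_face[OF multiaffine_diff[OF p(1) q(1)] face] y by blast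
      with p(2) q(2) y show ?thesis
        by simp
    qed
    then show "h y = ?g y"
      by (simp add: vec_eq_iff)
  qed
  have "cell_map L \<sigma> = ?g"
    unfolding cell_map_def
    by (rule the_equality) (use interp uniq in auto)
  with x show ?thesis
    by simp
qed

lemma mem_box_of_unit_cube:
  assumes pos: "\<And>i. 0 < n i" and x: "x \<in> box_of n"
  obtains w where "integer_point w" "unit_cube_at w \<subseteq> box_of n" "x \<in> unit_cube_at w"
proof -
  \<comment> \<open>The floor is the natural lower corner, but for \<open>x $ i = n i\<close> its
    cube would stick out of the box; the minimum moves it back by one. Positivity of
    \<open>n i\<close> keeps the result nonnegative.\<close>
  define k where "k i = min \<lfloor>x $ i\<rfloor> (int (n i) - 1)" for i
  let ?w = "\<chi> i. real_of_int (k i)"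
  have x_bounds: "0 \<le> x $ i" "x $ i \<le> real (n i)" for i
    using x by (auto simp: box_of_def)
  have k: "0 \<le> real_of_int (k i)" "real_of_int (k i) + 1 \<le> real (n i)"
    "real_of_int (k i) \<le> x $ i" "x $ i \<le> real_of_int (k i) + 1" for i
  proof -
    have "0 \<le> \<lfloor>x $ i\<rfloor>"
      using x_bounds(1)[of i] by simp
    then show "0 \<le> real_of_int (k i)"
      using pos[of i] by (simp add: k_def)
    have "k i + 1 \<le> int (n i)"
      by (simp add: k_def)
    then show "real_of_int (k i) + 1 \<le> real (n i)"
      by linarith
    show "real_of_int (k i) \<le> x $ i"
      unfolding k_def by linarith
    show "x $ i \<le> real_of_int (k i) + 1"
      using x_bounds(2)[of i] unfolding k_def by linarith
  qed
  show thesis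
  proof
    show "integer_point ?w"
      by (simp add: integer_point_def)
    show "unit_cube_at ?w \<subseteq> box_of n"
      using order_trans[OF k(1)] order_trans[OF _ k(2)]
      by (simp add: mem_unit_cube_at box_of_def subset_iff) blast
    show "x \<in> unit_cube_at ?w"
      using k by (simp add: mem_unit_cube_at)
  qed
qed

section \<open>Boundary values\<close>

text \<open>In a unit cube around \<open>x\<close>, the face \<open>H\<close> cuts out a face of the
  cube. Its extreme points are pile vertices in \<open>H\<close>, where the value is
  \<open>c\<close>, and a multiaffine function is determined by these values.\<close>

lemma pile_interp_const_on_face:
  assumes pos: "\<And>i. 0 < n i" and H: "H face_of box_of n"
    and L: "\<And>u. u \<in> pile_vertices n \<Longrightarrow> u \<in> H \<Longrightarrow> L u $ i = c"
    and x: "x \<in> H"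
  shows "pile_interp n L x $ i = c"
proof -
  have "x \<in> box_of n"
    using H x face_of_imp_subset by blast
  then obtain w where w: "integer_point w" "unit_cube_at w \<subseteq> box_of n" "x \<in> unit_cube_at w"
    by (rule mem_box_of_unit_cube[OF pos])
  obtain p where p: "multiaffine p" "\<And>x. x \<in> unit_cube_at w \<Longrightarrow> pile_interp n L x $ i = p x"
    using pile_interp_multiaffine[OF w(1)] by blast
  \<comment> \<open>Slicing with a convex set preserves faces; as the cube lies in the box, the
    sliced box is the cube itself.\<close>
  have "H \<inter> unit_cube_at w face_of box_of n \<inter> unit_cube_at w"
    by (rule face_of_slice[OF H]) (simp add: unit_cube_at_def)
  then have face: "H \<inter> unit_cube_at w face_of unit_cube_at w"
    using w(2) by (simp add: Int_absorb1)
  have "p u - c = 0" if u: "u extreme_point_of H \<inter> unit_cube_at w" for u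
  proof -
    have "u \<in> pile_vertices n"
      using face_extreme_point_pile_vertex[OF w(1,2) face u] .
    moreover have "u \<in> H" "u \<in> unit_cube_at w"
      using u by (auto simp: extreme_point_of_def)
    ultimately show ?thesis
      using p(2)[of u] L[of u] pile_interp_vertex[of u n L] by simp
  qed
  then have "p x - c = 0"
    using multiaffine_zero_on_face[OF multiaffine_diff[OF p(1) multiaffine_const] face] x w(3)
    by blast
  with p(2) w(3) show ?thesis
    by simp
qed

text \<open>The Sperner condition speaks about the smallest face containing \<open>v\<close>; it is inherited by every
  larger face.\<close>

lemma sperner_labelling_face_coord:
  assumes L: "sperner_labelling n L" and H: "H face_of box_of n"
    and corners: "\<And>e. e \<in> cube_vertices \<Longrightarrow> corner n e \<in> H \<Longrightarrow> e $ i = c"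
    and v: "v \<in> pile_vertices n" "v \<in> H"
  shows "L v $ i = c"
proof -
  have "polytope (box_of n)"
    by (simp add: box_of_eq_cbox polytope_interval)
  moreover have "v \<in> box_of n"
    using v by (simp add: pile_vertices_def)
  ultimately obtain F where F: "F face_of box_of n" "v \<in> rel_interior F"
    by (rule polytope_rel_interior_face_exists)
  \<comment> \<open>A face that meets the relative interior of a subset contains that
    subset.\<close>
  have "F \<subseteq> H"
    using subset_of_face_of[OF H face_of_imp_subset[OF F(1)]] F(2) v(2) by blast
  \<comment> \<open>The spanning vertices lie in a hyperplane, which is convex and therefore
    contains their hull.\<close>
  then have "{e \<in> cube_vertices. corner n e \<in> F} \<subseteq> {e. e $ i = c}"
    using corners by blast
  moreover have "convex {e :: real^'a. e $ i = c}"
    by (auto simp: convex_alt algebra_simps)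
  ultimately have "corresponding_face n F \<subseteq> {e. e $ i = c}"
    unfolding corresponding_face_def by (rule hull_minimal)
  moreover have "L v \<in> corresponding_face n F"
    using L F v(1) unfolding sperner_labelling_def extreme_point_of_def by blast
  ultimately show ?thesis
    by blast
qed

lemma box_of_facets:
  "box_of n \<inter> {x. x $ i = 0} face_of box_of n"
  "box_of n \<inter> {x. x $ i = real (n i)} face_of box_of n"
proof -
  have "convex (box_of n)"
    by (simp add: box_of_eq_cbox)
  \<comment> \<open>Coordinates are written as inner products so that both sets appear as sections
    by supporting hyperplanes.\<close>
  then have "box_of n \<inter> {x. axis i 1 \<bullet> x = 0} face_of box_of n"
    "box_of n \<inter> {x. axis i 1 \<bullet> x = real (n i)} face_of box_of n"
    by (intro face_of_Int_supporting_hyperplane_ge face_of_Int_supporting_hyperplane_le;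
        simp add: box_of_def inner_axis')+
  then show "box_of n \<inter> {x. x $ i = 0} face_of box_of n"
    "box_of n \<inter> {x. x $ i = real (n i)} face_of box_of n"
    by (simp_all add: inner_axis')
qed

lemma sperner_pile_interp_boundary:
  assumes pos: "\<And>i. 0 < n i" and L: "sperner_labelling n L" and x: "x \<in> box_of n"
  shows "x $ i = 0 \<Longrightarrow> pile_interp n L x $ i = 0"
    and "x $ i = real (n i) \<Longrightarrow> pile_interp n L x $ i = 1"
proof -
  \<comment> \<open>A corner has coordinate \<open>e $ i * n i\<close>; with \<open>n i\<close>
    nonzero, lying on the lower facet forces \<open>e $ i = 0\<close>, and lying on the upper one
    forces \<open>e $ i = 1\<close>.\<close>
  have "n i \<noteq> 0"
    using pos[of i] by simp
  then show "pile_interp n L x $ i = 0" if "x $ i = 0"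
    using x that
    by (intro pile_interp_const_on_face[OF pos box_of_facets(1)[of n i]]
        sperner_labelling_face_coord[OF L box_of_facets(1)[of n i]]) (auto simp: corner_def)
  show "pile_interp n L x $ i = 1" if "x $ i = real (n i)"
    using x that \<open>n i \<noteq> 0\<close>
    by (intro pile_interp_const_on_face[OF pos box_of_facets(2)[of n i]]
        sperner_labelling_face_coord[OF L box_of_facets(2)[of n i]]) (auto simp: corner_def)
qed

section \<open>A cell on which the centre of the cube is attained\<close>

theorem theoremB:
  fixes n :: "'d::finite \<Rightarrow> nat" and L :: "real^'d \<Rightarrow> real^'d"
  assumes "\<And>i. 0 < n i"
    and "sperner_labelling n L"
  shows "\<exists>\<sigma>\<in>pile_cells n. centrally_labelled L \<sigma>"
proof -
  let ?half = "(\<chi> i. 1/2) :: real^'d"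
  \<comment> \<open>The shift turns the boundary values 0 and 1 into -1/2 and 1/2, the signs
    required for a zero.\<close>
  let ?f = "\<lambda>x. pile_interp n L x - ?half"
  obtain x where x: "x \<in> box_of n" "?f x = 0"
  proof (rule Poincare_Miranda[of 0 "\<chi> i. real (n i)" ?f])
    show "continuous_on (cbox 0 (\<chi> i. real (n i))) ?f"
      by (intro continuous_intros continuous_on_pile_interp)
    show "0 \<bullet> b < (\<chi> i. real (n i)) \<bullet> b" if "b \<in> Basis" for b :: "real^'d"
      using that assms(1) by (auto simp: Basis_vec_def inner_axis)
    show "?f y \<bullet> b \<le> 0" if "y \<in> cbox 0 (\<chi> i. real (n i))" "b \<in> Basis" "y \<bullet> b = 0 \<bullet> b" for y b
      using that sperner_pile_interp_boundary(1)[OF assms]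
      by (auto simp: Basis_vec_def inner_axis simp flip: box_of_eq_cbox)
    show "?f y \<bullet> b \<ge> 0"
      if "y \<in> cbox 0 (\<chi> i. real (n i))" "b \<in> Basis" "y \<bullet> b = (\<chi> i. real (n i)) \<bullet> b" for y b
      using that sperner_pile_interp_boundary(2)[OF assms]
      by (auto simp: Basis_vec_def inner_axis simp flip: box_of_eq_cbox)
  qed (simp flip: box_of_eq_cbox)
  obtain w where w: "integer_point w" "unit_cube_at w \<subseteq> box_of n" "x \<in> unit_cube_at w"
    using mem_box_of_unit_cube[OF assms(1) x(1)] by blast
  \<comment> \<open>The point may lie on the boundary of the unit cube, so the cell is the face that
    has it in its relative interior.\<close>
  obtain \<sigma> where \<sigma>: "\<sigma> face_of unit_cube_at w" "x \<in> rel_interior \<sigma>"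
    using polytope_rel_interior_face_exists[OF _ w(3)] by (auto simp: unit_cube_at_def polytope_interval)
  then have "x \<in> \<sigma>"
    using rel_interior_subset by blast
  then have "cell_map L \<sigma> x = ?half"
    using cell_map_eq_pile_interp[OF w(1,2) \<sigma>(1), of x L] x(2) by simp
  moreover have "\<sigma> \<in> pile_cells n"
    using w \<sigma>(1) \<open>x \<in> \<sigma>\<close> by (auto simp: pile_cells_def)
  ultimately show ?thesis
    using \<sigma>(2) unfolding centrally_labelled_def by blast
qed

end
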